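(* For any graphs $G$ and $H$ with $|V(H)|\ge 3$, $$\mu_{\mathrm{int}}(G\odot H)\le \max\left\{\mu_{\mathrm{int}}(G),\ \left\lceil \frac{|V(H)|}{3}\right\rceil,\ \Delta(H)+1\right\},$$ where $\Delta(H)$ is the maximum degree of $H$.
   Context: Graphs are finite and simple. For graphs $G$ and $H$ with $V(G)=\{v_1,\dots,v_n\}$, the corona product $G\odot H$ is the graph obtained by taking $G$ and $n$ disjoint copies $H_1,\dots,H_n$ of $H$ and, for each $i\in\{1,\dots,n\}$, adding the edge $v_ix$ for every $x\in V(H_i)$. An improper interval coloring of a graph $G$ is an assignment of colors (natural numbers) to the edges of $G$, not necessarily proper, such that for every vertex $v$ the set of colors on the edges incident with $v$ is an integral interval (a set of consecutive integers). It is $k$-improper if at most $k$ edges with the same color all share a common endpoint, i.e. at each vertex each color appears on at most $k$ incident edges. The interval coloring impropriety $\mu_{\mathrm{int}}(G)$ is the smallest positive integer $k$ such that $G$ has a $k$-improper interval coloring. *)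

theory Defs
  imports Complex_Main
begin

datatype 'a ugraph = Graph (verts: "'a set") (edges: "'a set set")

definition simple_graph :: "'a ugraph \<Rightarrow> bool" where
  "simple_graph G \<longleftrightarrow> finite (verts G) \<and> (\<forall>e\<in>edges G. e \<subseteq> verts G \<and> card e = 2)"

definition incident_edges :: "'a ugraph \<Rightarrow> 'a \<Rightarrow> 'a set set" where
  "incident_edges G v = {e \<in> edges G. v \<in> e}"

definition degree :: "'a ugraph \<Rightarrow> 'a \<Rightarrow> nat" where
  "degree G v = card (incident_edges G v)"

text \<open>Meaningful only for finite graphs with at least one vertex.\<close>
definition max_degree :: "'a ugraph \<Rightarrow> nat" where
  "max_degree G = Max (degree G ` verts G)"

text \<open>The vertex \<open>Inr (v, x)\<close> is the copy of \<open>x\<close> in the copy of \<open>H\<close> attached to \<open>v\<close>.\<close>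
definition corona :: "'a ugraph \<Rightarrow> 'b ugraph \<Rightarrow> ('a + 'a \<times> 'b) ugraph" where
  "corona G H = Graph
     (verts G <+> (verts G \<times> verts H))
     ({Inl ` e | e. e \<in> edges G} \<union>
      {(\<lambda>x. Inr (v, x)) ` e | v e. v \<in> verts G \<and> e \<in> edges H} \<union>
      {{Inl v, Inr (v, x)} | v x. v \<in> verts G \<and> x \<in> verts H})"

text \<open>The case \<open>b < a\<close> gives the empty set, so isolated vertices impose no condition.\<close>
definition improper_interval_coloring :: "'a ugraph \<Rightarrow> ('a set \<Rightarrow> nat) \<Rightarrow> bool" where
  "improper_interval_coloring G c \<longleftrightarrow>
     (\<forall>v\<in>verts G. \<exists>a b. c ` incident_edges G v = {a..b})"

definition k_improper :: "nat \<Rightarrow> 'a ugraph \<Rightarrow> ('a set \<Rightarrow> nat) \<Rightarrow> bool" where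
  "k_improper k G c \<longleftrightarrow>
     (\<forall>v\<in>verts G. \<forall>i. card {e \<in> incident_edges G v. c e = i} \<le> k)"

definition mu_int :: "'a ugraph \<Rightarrow> nat" where
  "mu_int G = (LEAST k. k > 0 \<and> (\<exists>c. improper_interval_coloring G c \<and> k_improper k G c))"

lemma finite_edges: "simple_graph G \<Longrightarrow> finite (edges G)"
  unfolding simple_graph_def
  by (rule finite_subset[of _ "Pow (verts G)"]) auto

lemma simple_graph_corona:
  assumes "simple_graph G" "simple_graph H"
  shows "simple_graph (corona G H)"
proof -
  have "card (Inl ` e :: ('a + 'a \<times> 'b) set) = card e" for e :: "'a set"
    by (simp add: card_image)
  moreover have "card ((\<lambda>x. Inr (v, x)) ` e :: ('a + 'a \<times> 'b) set) = card e"
    for v and e :: "'b set"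
    by (rule card_image) (auto simp: inj_on_def)
  ultimately show ?thesis
    using assms unfolding simple_graph_def corona_def by fastforce
qed

text \<open>The set minimised over in \<^const>\<open>mu_int\<close> is nonempty: color all edges alike.\<close>
lemma mu_int_exists:
  assumes "simple_graph G"
  shows "\<exists>k>0. \<exists>c. improper_interval_coloring G c \<and> k_improper k G c"
proof (intro exI conjI)
  show "0 < Suc (card (edges G))" by simp
  have "\<exists>a b. (\<lambda>_. 0::nat) ` incident_edges G v = {a..b}" for v
  proof (cases "incident_edges G v = {}")
    case True
    then have "(\<lambda>_. 0::nat) ` incident_edges G v = {1..0}" by simp
    then show ?thesis by blast
  next
    case False
    then have "(\<lambda>_. 0::nat) ` incident_edges G v = {0..0}" by auto
    then show ?thesis by blast
  qed
  then show "improper_interval_coloring G (\<lambda>_. 0)"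
    unfolding improper_interval_coloring_def by blast
  have "card {e \<in> incident_edges G v. 0 = i} \<le> card (edges G)" for v and i :: nat
    by (rule card_mono[OF finite_edges[OF assms]]) (auto simp: incident_edges_def)
  then show "k_improper (Suc (card (edges G))) G (\<lambda>_. 0)"
    unfolding k_improper_def using le_SucI by blast
qed

end

theory Submission
  imports Defs
begin

text \<open>
  Write \<open>k\<close> for the bound and \<open>n\<close> for the order of \<open>H\<close>. Start from a \<open>k\<close>-improper interval
  coloring \<open>c\<close> of \<open>G\<close> and let \<open>t v\<close> be the first color above the interval that \<open>c\<close> shows at \<open>v\<close>.
  Color the \<open>n\<close> edges that join \<open>v\<close> to its copy of \<open>H\<close> (the spokes at \<open>v\<close>) by using up the
  colors \<open>t v\<close>, \<open>t v + 1\<close>, \<open>t v + 2\<close> in this order, each at most \<open>k\<close> times; three colors suffice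
  because \<open>n \<le> 3 k\<close>. At \<open>v\<close> the spokes then prolong the old interval without touching its colors,
  so \<open>v\<close> still sees an interval, and every color at most \<open>k\<close> times.

  Give all edges inside the copy of \<open>H\<close> at \<open>v\<close> the middle color \<open>t v + 1\<close>. A vertex of the copy
  then sees this color and the color of its one spoke, which differs from it by at most one, so it
  sees an interval. It has at most \<open>\<Delta>(H) + 1 \<le> k\<close> incident edges altogether, so no color can occur
  there more than \<open>k\<close> times.
\<close>

section \<open>Incidence in the corona\<close>

abbreviation spoke :: "'a \<Rightarrow> 'b \<Rightarrow> ('a + 'a \<times> 'b) set" where
  "spoke v x \<equiv> {Inl v, Inr (v, x)}"

abbreviation copy_edge :: "'a \<Rightarrow> 'b set \<Rightarrow> ('a + 'a \<times> 'b) set" where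
  "copy_edge v e \<equiv> (\<lambda>x. Inr (v, x)) ` e"

lemma incident_edges_corona_Inl:
  assumes "v \<in> verts G"
  shows "incident_edges (corona G H) (Inl v) =
    (`) Inl ` incident_edges G v \<union> spoke v ` verts H"
  using assms unfolding incident_edges_def corona_def by auto

lemma incident_edges_corona_Inr:
  assumes "simple_graph H" "v \<in> verts G" "x \<in> verts H"
  shows "incident_edges (corona G H) (Inr (v, x)) =
    insert (spoke v x) (copy_edge v ` incident_edges H x)"
  using assms unfolding incident_edges_def corona_def by auto

lemma finite_incident_edges: "simple_graph G \<Longrightarrow> finite (incident_edges G v)"
  using finite_edges[of G] by (simp add: incident_edges_def)

lemma degree_le_max_degree:
  assumes "simple_graph G" "v \<in> verts G"
  shows "degree G v \<le> max_degree G"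
  using assms unfolding max_degree_def simple_graph_def by (intro Max_ge) auto

section \<open>Colorings attaining the impropriety\<close>

lemma mu_int_le:
  assumes "k > 0" "improper_interval_coloring G c" "k_improper k G c"
  shows "mu_int G \<le> k"
  unfolding mu_int_def by (rule Least_le) (use assms in blast)

lemma k_improper_mono: "k_improper k G c \<Longrightarrow> k \<le> l \<Longrightarrow> k_improper l G c"
  unfolding k_improper_def using le_trans by blast

lemma mu_int_leE:
  assumes "simple_graph G" "mu_int G \<le> k"
  obtains c where "improper_interval_coloring G c" "k_improper k G c"
proof -
  have "\<exists>c. improper_interval_coloring G c \<and> k_improper (mu_int G) G c"
    using LeastI_ex[OF mu_int_exists[OF assms(1)]] unfolding mu_int_def by blast
  then show ?thesis
    using that k_improper_mono assms(2) by blast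
qed

text \<open>
  With half-open intervals, isolated vertices need no separate treatment: there \<open>t v\<close> is arbitrary.
\<close>
lemma improper_interval_coloring_upper:
  assumes "improper_interval_coloring G c"
  obtains t where "\<And>v. v \<in> verts G \<Longrightarrow> \<exists>a. c ` incident_edges G v = {a..<t v}"
proof -
  have "\<forall>v\<in>verts G. \<exists>t a. c ` incident_edges G v = {a..<t}"
    using assms unfolding improper_interval_coloring_def
    by (metis atLeastLessThanSuc_atLeastAtMost)
  then show ?thesis
    using that by metis
qed

section \<open>Distributing objects over consecutive colors\<close>

text \<open>
  Numbering the objects from \<open>0\<close> and dividing the number by \<open>k\<close> fills the colors one after the
  other, so the colors in use have no gaps.
\<close>
lemma consecutive_distribution:
  fixes k :: nat
  assumes "finite A" "k > 0"
  obtains h :: "'b \<Rightarrow> nat" where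
    "\<exists>q. h ` A = {0..<q}"
    "\<And>i. card {x \<in> A. h x = i} \<le> k"
    "\<And>x m. card A \<le> m * k \<Longrightarrow> x \<in> A \<Longrightarrow> h x < m"
proof -
  obtain f where f: "bij_betw f A {0..<card A}"
    using ex_bij_betw_finite_nat[OF assms(1)] by blast
  have inj: "inj_on f A" and img: "f ` A = {0..<card A}"
    using f by (auto simp: bij_betw_def)
  define h where "h = (\<lambda>x. f x div k)"
  have "h ` A = (\<lambda>j. j div k) ` {0..<card A}"
    unfolding h_def img[symmetric] by (simp add: image_image)
  \<comment> \<open>The quotient is the number of blocks of length \<open>k\<close> that meet the numbers below \<open>card A\<close>.\<close>
  also have "\<dots> = {0..<(card A + k - 1) div k}"
  proof (intro equalityI subsetI)
    fix i assume "i \<in> (\<lambda>j. j div k) ` {0..<card A}"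
    then obtain j where "j < card A" and i: "i = j div k" by auto
    then have "j + k \<le> card A + k - 1" by simp
    then have "(j + k) div k \<le> (card A + k - 1) div k" by (rule div_le_mono)
    then show "i \<in> {0..<(card A + k - 1) div k}"
      using assms(2) i by simp
  next
    fix i assume "i \<in> {0..<(card A + k - 1) div k}"
    then have "Suc i \<le> (card A + k - 1) div k" by simp
    then have "Suc i * k \<le> card A + k - 1"
      using assms(2) by (simp add: less_eq_div_iff_mult_less_eq)
    then have "i * k < card A" using assms(2) by simp
    then show "i \<in> (\<lambda>j. j div k) ` {0..<card A}"
      using assms(2) by (intro image_eqI[of _ _ "i * k"]) auto
  qed
  finally have 1: "\<exists>q. h ` A = {0..<q}" by blast
  have 2: "card {x \<in> A. h x = i} \<le> k" for i
  proof -
    have "f ` {x \<in> A. h x = i} \<subseteq> {i * k..<i * k + k}"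
    proof (safe, unfold h_def)
      fix x
      show "f x \<in> {f x div k * k..<f x div k * k + k}"
        using div_mult_mod_eq[of "f x" k] mod_less_divisor[OF assms(2), of "f x"]
        unfolding atLeastLessThan_iff by linarith
    qed
    then have "card (f ` {x \<in> A. h x = i}) \<le> card {i * k..<i * k + k}"
      by (intro card_mono) auto
    moreover have "card (f ` {x \<in> A. h x = i}) = card {x \<in> A. h x = i}"
      by (rule card_image) (use inj in \<open>auto simp: inj_on_def\<close>)
    ultimately show ?thesis by simp
  qed
  have 3: "h x < m" if "card A \<le> m * k" "x \<in> A" for x m
  proof -
    have "f x < card A" using img that(2) by auto
    then have "f x < m * k" using that(1) by simp
    then show ?thesis
      unfolding h_def by (simp add: less_mult_imp_div_less)
  qed
  show ?thesis using that 1 2 3 by blast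
qed

section \<open>The coloring of the corona\<close>

text \<open>
  All vertices \<open>Inr p\<close> of an edge lie in the same copy of \<open>H\<close>, so any choice of \<open>p\<close> reveals the
  vertex \<open>v\<close> to which the copy is attached. A spoke contains just one of them, so there the choice
  also reveals its end in the copy.
\<close>
definition corona_coloring ::
    "('a set \<Rightarrow> nat) \<Rightarrow> ('a \<Rightarrow> nat) \<Rightarrow> ('b \<Rightarrow> nat) \<Rightarrow> ('a + 'a \<times> 'b) set \<Rightarrow> nat" where
  "corona_coloring c t h e =
    (if e \<subseteq> range Inl then c (Inl -` e)
     else let p = SOME p. Inr p \<in> e
          in t (fst p) + (if e \<inter> range Inl = {} then 1 else h (snd p)))"

lemma corona_coloring_base: "corona_coloring c t h (Inl ` e) = c e"
  by (auto simp: corona_coloring_def inj_vimage_image_eq)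

lemma corona_coloring_spoke: "corona_coloring c t h (spoke v x) = t v + h x"
  by (auto simp: corona_coloring_def Let_def)

lemma corona_coloring_copy:
  assumes "e \<noteq> {}"
  shows "corona_coloring c t h (copy_edge v e) = t v + 1"
proof -
  obtain x where "x \<in> e" using assms by blast
  then have "Inr (v, x) \<in> copy_edge v e" by blast
  then have "Inr (SOME p. Inr p \<in> copy_edge v e) \<in> copy_edge v e" by (rule someI)
  moreover have "\<not> copy_edge v e \<subseteq> range Inl" using assms by auto
  moreover have "copy_edge v e \<inter> range Inl = {}" by auto
  ultimately show ?thesis by (auto simp: corona_coloring_def Let_def)
qed

lemma interval_insert_adjacent:
  fixes i j :: nat
  assumes "S \<subseteq> {j}" "i \<le> Suc j" "j \<le> Suc i"
  shows "\<exists>a b. insert i S = {a..b}"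
proof (cases "S = {}")
  case True
  then have "insert i S = {i..i}" by simp
  then show ?thesis by blast
next
  case False
  with assms(1) have "S = {j}" by blast
  moreover have "{i, j} = {min i j..max i j}" using assms(2,3) by auto
  ultimately have "insert i S = {min i j..max i j}" by simp
  then show ?thesis by blast
qed

lemma interval_append:
  fixes t :: nat
  shows "\<exists>a' b'. {a..<t} \<union> {t..<t + q} = {a'..b'}"
proof -
  have "\<exists>a b. {m..<n} = {a..b}" for m n :: nat
  proof (cases n)
    case 0
    then have "{m..<n} = {1..0}" by simp
    then show ?thesis by blast
  next
    case (Suc n')
    then show ?thesis using atLeastLessThanSuc_atLeastAtMost by blast
  qed
  moreover have "{a..<t} \<union> {t..<t + q} = {min a t..<t + q}" by auto
  ultimately show ?thesis by presburger
qed

lemma improper_interval_coloring_corona: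
  fixes G :: "'a ugraph" and H :: "'b ugraph"
  assumes H: "simple_graph H"
    and t: "\<And>v. v \<in> verts G \<Longrightarrow> \<exists>a. c ` incident_edges G v = {a..<t v}"
    and h: "h ` verts H = {0..<q}"
    and h3: "\<And>x. x \<in> verts H \<Longrightarrow> h x < 3"
  shows "improper_interval_coloring (corona G H) (corona_coloring c t h)"
    (is "improper_interval_coloring _ ?d")
  unfolding improper_interval_coloring_def
proof
  fix u assume "u \<in> verts (corona G H)"
  then consider v where "u = Inl v" "v \<in> verts G"
    | v x where "u = Inr (v, x)" "v \<in> verts G" "x \<in> verts H"
    by (auto simp: corona_def)
  then show "\<exists>a b. ?d ` incident_edges (corona G H) u = {a..b}"
  proof cases
    case 1
    obtain a where a: "c ` incident_edges G v = {a..<t v}"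
      using t 1(2) by blast
    have "?d ` incident_edges (corona G H) u =
        c ` incident_edges G v \<union> (+) (t v) ` h ` verts H"
      by (simp add: 1 incident_edges_corona_Inl image_Un image_image
          corona_coloring_base corona_coloring_spoke)
    also have "\<dots> = {a..<t v} \<union> {t v..<t v + q}"
      unfolding a h by (simp add: add.commute)
    finally show ?thesis using interval_append by metis
  next
    case 2
    have "e \<noteq> {}" if "e \<in> incident_edges H x" for e
      using that by (auto simp: incident_edges_def)
    then have "?d ` copy_edge v ` incident_edges H x \<subseteq> {t v + 1}"
      by (auto simp: corona_coloring_copy)
    moreover have "?d ` incident_edges (corona G H) u =
        insert (t v + h x) (?d ` copy_edge v ` incident_edges H x)"
      by (simp add: 2 H incident_edges_corona_Inr corona_coloring_spoke)
    ultimately show ?thesis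
      using interval_insert_adjacent[of _ "t v + 1" "t v + h x"] h3[OF 2(3)] by simp
  qed
qed

lemma k_improper_corona:
  fixes G :: "'a ugraph" and H :: "'b ugraph"
  assumes G: "simple_graph G" and H: "simple_graph H"
    and c: "k_improper k G c"
    and t: "\<And>v. v \<in> verts G \<Longrightarrow> \<exists>a. c ` incident_edges G v = {a..<t v}"
    and h: "\<And>i. card {x \<in> verts H. h x = i} \<le> k"
    and deg: "max_degree H + 1 \<le> k"
  shows "k_improper k (corona G H) (corona_coloring c t h)"
    (is "k_improper _ _ ?d")
  unfolding k_improper_def
proof (intro ballI allI)
  fix u i assume "u \<in> verts (corona G H)"
  then consider v where "u = Inl v" "v \<in> verts G"
    | v x where "u = Inr (v, x)" "v \<in> verts G" "x \<in> verts H"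
    by (auto simp: corona_def)
  then show "card {e \<in> incident_edges (corona G H) u. ?d e = i} \<le> k"
  proof cases
    case 1
    have below: "c e < t v" if "e \<in> incident_edges G v" for e
      using t[OF 1(2)] that by fastforce
    have inc: "incident_edges (corona G H) u =
        (`) Inl ` incident_edges G v \<union> spoke v ` verts H"
      using 1 by (simp add: incident_edges_corona_Inl)
    \<comment> \<open>Colors below \<open>t v\<close> occur only on old edges at \<open>v\<close>, the others only on spokes.\<close>
    show ?thesis
    proof (cases "i < t v")
      case True
      then have "{e \<in> incident_edges (corona G H) u. ?d e = i} \<subseteq>
          (`) Inl ` {e \<in> incident_edges G v. c e = i}"
        unfolding inc by (auto simp: corona_coloring_base corona_coloring_spoke)
      then have "card {e \<in> incident_edges (corona G H) u. ?d e = i} \<le>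
          card {e \<in> incident_edges G v. c e = i}"
        by (rule surj_card_le[rotated]) (simp add: G finite_incident_edges)
      also have "\<dots> \<le> k" using c 1(2) unfolding k_improper_def by blast
      finally show ?thesis .
    next
      case False
      then have "{e \<in> incident_edges (corona G H) u. ?d e = i} \<subseteq>
          spoke v ` {x \<in> verts H. h x = i - t v}"
        unfolding inc using below
        by (fastforce simp: corona_coloring_base corona_coloring_spoke)
      then have "card {e \<in> incident_edges (corona G H) u. ?d e = i} \<le>
          card {x \<in> verts H. h x = i - t v}"
        by (rule surj_card_le[rotated]) (use H in \<open>simp add: simple_graph_def\<close>)
      also have "\<dots> \<le> k" by (rule h)
      finally show ?thesis .
    qed
  next
    case 2
    have fin: "finite (incident_edges H x)" by (rule finite_incident_edges[OF H])
    have "{e \<in> incident_edges (corona G H) u. ?d e = i} \<subseteq>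
        insert (spoke v x) (copy_edge v ` incident_edges H x)"
      using 2 H by (auto simp: incident_edges_corona_Inr)
    then have "card {e \<in> incident_edges (corona G H) u. ?d e = i} \<le>
        card (insert (spoke v x) (copy_edge v ` incident_edges H x))"
      by (rule card_mono[rotated]) (simp add: fin)
    also have "\<dots> \<le> Suc (card (copy_edge v ` incident_edges H x))"
      by (rule card_insert_le_m1) auto
    also have "\<dots> \<le> Suc (degree H x)"
      unfolding degree_def using card_image_le[OF fin] by simp
    also have "\<dots> \<le> k"
      using degree_le_max_degree[OF H 2(3)] deg by simp
    finally show ?thesis .
  qed
qed

theorem theorem25:
  fixes G :: "'a ugraph" and H :: "'b ugraph"
  assumes "simple_graph G" and "simple_graph H" and "card (verts H) \<ge> 3"
  shows "mu_int (corona G H)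
    \<le> Max {mu_int G, nat \<lceil>real (card (verts H)) / 3\<rceil>, max_degree H + 1}"
proof -
  define k where "k = Max {mu_int G, nat \<lceil>real (card (verts H)) / 3\<rceil>, max_degree H + 1}"
  have mu: "mu_int G \<le> k" and third: "nat \<lceil>real (card (verts H)) / 3\<rceil> \<le> k"
    and deg: "max_degree H + 1 \<le> k"
    unfolding k_def by (rule Max_ge; simp)+
  have pos: "k > 0" using deg by simp
  have "real (card (verts H)) / 3 \<le> real k"
    using third by linarith
  then have n: "card (verts H) \<le> 3 * k" by linarith
  have fin: "finite (verts H)" using assms(2) by (simp add: simple_graph_def)
  obtain c where c: "improper_interval_coloring G c" "k_improper k G c"
    using mu_int_leE[OF assms(1) mu] by blast
  obtain t where t: "\<And>v. v \<in> verts G \<Longrightarrow> \<exists>a. c ` incident_edges G v = {a..<t v}"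
    using improper_interval_coloring_upper[OF c(1)] by blast
  obtain h :: "'b \<Rightarrow> nat" where h: "\<exists>q. h ` verts H = {0..<q}"
      "\<And>i. card {x \<in> verts H. h x = i} \<le> k"
      "\<And>x m. card (verts H) \<le> m * k \<Longrightarrow> x \<in> verts H \<Longrightarrow> h x < m"
    using consecutive_distribution[OF fin pos] by blast
  obtain q where q: "h ` verts H = {0..<q}" using h(1) by blast
  have "improper_interval_coloring (corona G H) (corona_coloring c t h)"
    using improper_interval_coloring_corona[OF assms(2) t q h(3)[OF n]] by blast
  moreover have "k_improper k (corona G H) (corona_coloring c t h)"
    using k_improper_corona[OF assms(1,2) c(2) t h(2) deg] by blast
  ultimately show ?thesis
    using mu_int_le[OF pos] unfolding k_def by blast
qed

end
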